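(* Let $d\ge2$. For every pair $A_1,A_2\subseteq\mathbb{R}^d$ of closed star bodies, $$d_{AW}(A_1,A_2)\le d_{AW^r}(A_1,A_2).$$
   Context: $\mathbb{N}=\{1,2,\dots\}$; $B_2^d$ and $\mathbb{S}^{d-1}$ are the closed Euclidean unit ball and the unit sphere of $\mathbb{R}^d$. A star set is a non-empty $A\subseteq\mathbb{R}^d$ with $ta\in A$ for all $a\in A$, $0\le t\le 1$. Its radial function is $\rho_A:\mathbb{S}^{d-1}\to[0,\infty]$, $\rho_A(\theta)=\sup\{\lambda\ge 0:\lambda\theta\in A\}$. A star body is a star set $A$ that is radially closed: $\rho_A(\theta)\theta\in A$ whenever $\rho_A(\theta)<\infty$; it need not be closed or bounded. The radial sum $A_1\tilde{+}A_2$ is the star body with radial function $\rho_{A_1}+\rho_{A_2}$. The radial distance from $x\in\mathbb{R}^d$ to a star body $A$ is $d_r(x,A)=\inf\{\alpha>0: x\in A\tilde{+}\alpha B_2^d\}\in[0,\infty)$, and the radial Attouch-Wets distance is $d_{AW^r}(A_1,A_2)=\sup_{j\in\mathbb{N}}\min\{\frac1j,\sup_{\|x\|\le j}|d_r(x,A_1)-d_r(x,A_2)|\}$. For non-empty closed $C\subseteq\mathbb{R}^d$, $d(x,C)=\inf_{c\in C}\|x-c\|$, and the Attouch-Wets distance of non-empty closed sets is $d_{AW}(C_1,C_2)=\sup_{j\in\mathbb{N}}\min\{\frac1j,\sup_{\|x\|<j}|d(x,C_1)-d(x,C_2)|\}$. *)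

theory Defs
  imports "HOL-Analysis.Analysis"
begin

definition star_set :: "'a::euclidean_space set \<Rightarrow> bool" where
  "star_set A \<longleftrightarrow> A \<noteq> {} \<and> (\<forall>a\<in>A. \<forall>t\<in>{0..1}. t *\<^sub>R a \<in> A)"

text \<open>The radial function is only meaningful for directions in \<open>sphere 0 1\<close>.\<close>

definition radial_fun :: "'a::euclidean_space set \<Rightarrow> 'a \<Rightarrow> ennreal" where
  "radial_fun A \<theta> = (SUP l\<in>{l. 0 \<le> l \<and> l *\<^sub>R \<theta> \<in> A}. ennreal l)"

definition star_body :: "'a::euclidean_space set \<Rightarrow> bool" where
  "star_body A \<longleftrightarrow> star_set A \<and>
     (\<forall>\<theta>\<in>sphere 0 1. radial_fun A \<theta> < \<infinity> \<longrightarrow> enn2real (radial_fun A \<theta>) *\<^sub>R \<theta> \<in> A)"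

text \<open>Existence and uniqueness of the described set are shown in \<open>radial_sum_ex1\<close> below.\<close>

definition radial_sum :: "'a::euclidean_space set \<Rightarrow> 'a set \<Rightarrow> 'a set" where
  "radial_sum A B = (THE C. star_body C \<and>
     (\<forall>\<theta>\<in>sphere 0 1. radial_fun C \<theta> = radial_fun A \<theta> + radial_fun B \<theta>))"

definition radial_infdist :: "'a::euclidean_space \<Rightarrow> 'a set \<Rightarrow> real" where
  "radial_infdist x A = Inf {\<alpha>. \<alpha> > 0 \<and> x \<in> radial_sum A ((*\<^sub>R) \<alpha> ` cball 0 1)}"

text \<open>The suprema below are suprema of bounded sets of reals: see \<open>bdd_above_radial_AW\<close>
  and \<open>bdd_above_AW\<close> for the inner ones; the outer ones are bounded by \<open>1\<close>.\<close>

definition radial_AW_dist :: "'a::euclidean_space set \<Rightarrow> 'a set \<Rightarrow> real" where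
  "radial_AW_dist A B =
     (SUP j\<in>{1::nat..}. min (1 / real j)
        (SUP x\<in>{x. norm x \<le> real j}. \<bar>radial_infdist x A - radial_infdist x B\<bar>))"

definition AW_dist :: "'a::euclidean_space set \<Rightarrow> 'a set \<Rightarrow> real" where
  "AW_dist A B =
     (SUP j\<in>{1::nat..}. min (1 / real j)
        (SUP x\<in>{x. norm x < real j}. \<bar>infdist x A - infdist x B\<bar>))"

lemma star_set_zero: "star_set A \<Longrightarrow> 0 \<in> A"
  unfolding star_set_def by (metis all_not_in_conv atLeastAtMost_iff order_refl scaleR_zero_left zero_le_one)

lemma star_set_scale:
  assumes "star_set A" "l *\<^sub>R \<theta> \<in> A" "0 \<le> r" "r \<le> l"
  shows "r *\<^sub>R \<theta> \<in> A"
proof (cases "l = 0")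
  case True
  then show ?thesis using assms by auto
next
  case False
  then have "l > 0" using assms by linarith
  then have "(r / l) *\<^sub>R (l *\<^sub>R \<theta>) \<in> A"
    using assms unfolding star_set_def by (metis atLeastAtMost_iff divide_le_eq_1_pos divide_nonneg_pos)
  then show ?thesis using False by simp
qed

lemma star_body_mem_iff:
  assumes A: "star_body A" and \<theta>: "norm \<theta> = 1" and r: "0 \<le> r"
  shows "r *\<^sub>R \<theta> \<in> A \<longleftrightarrow> ennreal r \<le> radial_fun A \<theta>"
proof
  assume "r *\<^sub>R \<theta> \<in> A"
  then show "ennreal r \<le> radial_fun A \<theta>"
    unfolding radial_fun_def using r by (intro SUP_upper) auto
next
  assume le: "ennreal r \<le> radial_fun A \<theta>"
  have S: "star_set A" using A by (simp add: star_body_def)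
  show "r *\<^sub>R \<theta> \<in> A"
  proof (cases "ennreal r = radial_fun A \<theta>")
    case True
    then have "radial_fun A \<theta> < \<infinity>" "enn2real (radial_fun A \<theta>) = r"
      using r by (auto simp flip: True)
    then show ?thesis using A \<theta> unfolding star_body_def by force
  next
    case False
    with le have "ennreal r < radial_fun A \<theta>" by simp
    then obtain l where "0 \<le> l" "l *\<^sub>R \<theta> \<in> A" "ennreal r < ennreal l"
      unfolding radial_fun_def less_SUP_iff by auto
    then show ?thesis
      using star_set_scale[OF S, of l \<theta> r] r by (simp add: ennreal_less_iff)
  qed
qed

lemma star_body_eqI:
  assumes "star_body A" "star_body B"
    and "\<And>\<theta>. \<theta> \<in> sphere 0 1 \<Longrightarrow> radial_fun A \<theta> = radial_fun B \<theta>"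
  shows "A = B"
proof (rule set_eqI)
  fix x
  show "x \<in> A \<longleftrightarrow> x \<in> B"
  proof (cases "x = 0")
    case True
    then show ?thesis using assms star_set_zero unfolding star_body_def by blast
  next
    case False
    then show ?thesis
      using star_body_mem_iff[OF assms(1), of "sgn x" "norm x"]
        star_body_mem_iff[OF assms(2), of "sgn x" "norm x"] assms(3)[of "sgn x"]
      by (simp add: norm_sgn sgn_div_norm)
  qed
qed

lemma star_body_with_radial_fun:
  fixes f :: "'a::euclidean_space \<Rightarrow> ennreal"
  defines "C \<equiv> {r *\<^sub>R \<theta> | r \<theta>. norm \<theta> = 1 \<and> 0 \<le> r \<and> ennreal r \<le> f \<theta>}"
  shows "star_body C" and "\<And>\<theta>. \<theta> \<in> sphere 0 1 \<Longrightarrow> radial_fun C \<theta> = f \<theta>"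
proof -
  have mem: "r *\<^sub>R \<theta> \<in> C \<longleftrightarrow> ennreal r \<le> f \<theta>" if "norm \<theta> = 1" "0 \<le> r" for r \<theta>
  proof
    assume "r *\<^sub>R \<theta> \<in> C"
    then obtain s \<phi> where *: "r *\<^sub>R \<theta> = s *\<^sub>R \<phi>" "norm \<phi> = 1" "0 \<le> s" "ennreal s \<le> f \<phi>"
      unfolding C_def by auto
    then have "r = s" using that by (metis abs_of_nonneg mult.right_neutral norm_scaleR)
    then show "ennreal r \<le> f \<theta>"
      using * by (cases "r = 0") auto
  qed (use that in \<open>auto simp: C_def\<close>)
  have rad: "radial_fun C \<theta> = f \<theta>" if "\<theta> \<in> sphere 0 1" for \<theta>
  proof (rule antisym)
    show "radial_fun C \<theta> \<le> f \<theta>"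
      unfolding radial_fun_def using mem that by (intro SUP_least) auto
    show "f \<theta> \<le> radial_fun C \<theta>"
    proof (rule dense_le)
      fix y assume y: "y < f \<theta>"
      then have fin: "y < top" by (meson less_le_trans top_greatest)
      then have "ennreal (enn2real y) = y" by simp
      then have "enn2real y *\<^sub>R \<theta> \<in> C" using mem[of \<theta> "enn2real y"] y that by simp
      then have "ennreal (enn2real y) \<le> radial_fun C \<theta>"
        unfolding radial_fun_def by (intro SUP_upper) auto
      then show "y \<le> radial_fun C \<theta>" using fin by simp
    qed
  qed
  then show "\<And>\<theta>. \<theta> \<in> sphere 0 1 \<Longrightarrow> radial_fun C \<theta> = f \<theta>" .
  obtain b :: 'a where "norm b = 1" using vector_choose_size[of 1] by auto
  then have "0 \<in> C" using mem[of b 0] by simp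
  moreover have "t *\<^sub>R a \<in> C" if a: "a \<in> C" and t: "t \<in> {0..1}" for a t
  proof -
    obtain r \<theta> where *: "a = r *\<^sub>R \<theta>" "norm \<theta> = 1" "0 \<le> r" "ennreal r \<le> f \<theta>"
      using a unfolding C_def by blast
    have "t * r \<le> r" using t * by (simp add: mult_left_le_one_le)
    then have "ennreal (t * r) \<le> f \<theta>" using * by (meson ennreal_leI order_trans)
    then show ?thesis using mem[of \<theta> "t * r"] * t by simp
  qed
  ultimately have "star_set C" unfolding star_set_def by auto
  moreover have "enn2real (radial_fun C \<theta>) *\<^sub>R \<theta> \<in> C"
    if "\<theta> \<in> sphere 0 1" "radial_fun C \<theta> < \<infinity>" for \<theta>
    using that mem[of \<theta> "enn2real (radial_fun C \<theta>)"] rad[of \<theta>] by simp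
  ultimately show "star_body C" unfolding star_body_def by auto
qed

lemma radial_sum_ex1:
  fixes A B :: "'a::euclidean_space set"
  shows "\<exists>!C. star_body C \<and>
     (\<forall>\<theta>\<in>sphere 0 1. radial_fun C \<theta> = radial_fun A \<theta> + radial_fun B \<theta>)"
proof (rule ex_ex1I)
  show "\<exists>C. star_body C \<and> (\<forall>\<theta>\<in>sphere 0 1. radial_fun C \<theta> = radial_fun A \<theta> + radial_fun B \<theta>)"
    using star_body_with_radial_fun[where f = "\<lambda>\<theta>. radial_fun A \<theta> + radial_fun B \<theta>"] by blast
qed (rule star_body_eqI; simp)

lemma
  fixes A B :: "'a::euclidean_space set"
  shows star_body_radial_sum: "star_body (radial_sum A B)"
    and radial_fun_radial_sum: "\<theta> \<in> sphere 0 1 \<Longrightarrow>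
      radial_fun (radial_sum A B) \<theta> = radial_fun A \<theta> + radial_fun B \<theta>"
  using theI'[OF radial_sum_ex1[of A B]] unfolding radial_sum_def by auto

lemma mem_radial_sum_ball:
  fixes x :: "'a::euclidean_space"
  assumes "\<alpha> > 0" "norm x \<le> \<alpha>"
  shows "x \<in> radial_sum A ((*\<^sub>R) \<alpha> ` cball 0 1)"
proof (cases "x = 0")
  case True
  then show ?thesis
    using star_body_radial_sum star_set_zero unfolding star_body_def by blast
next
  case False
  let ?B = "(*\<^sub>R) \<alpha> ` cball (0::'a) 1"
  have s: "norm (sgn x) = 1" using False by (simp add: norm_sgn)
  have "\<alpha> *\<^sub>R sgn x \<in> ?B" using s by auto
  then have "ennreal \<alpha> \<le> radial_fun ?B (sgn x)"
    unfolding radial_fun_def using assms by (intro SUP_upper) auto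
  then have "ennreal (norm x) \<le> radial_fun A (sgn x) + radial_fun ?B (sgn x)"
    using assms by (meson add_increasing ennreal_leI order_trans zero_le)
  then have "norm x *\<^sub>R sgn x \<in> radial_sum A ?B"
    using s by (subst star_body_mem_iff[OF star_body_radial_sum]) (auto simp: radial_fun_radial_sum)
  then show ?thesis using False by (simp add: sgn_div_norm)
qed

lemma radial_infdist_nonneg: "0 \<le> radial_infdist x A"
  unfolding radial_infdist_def
proof (rule cInf_greatest)
  show "{\<alpha>. \<alpha> > 0 \<and> x \<in> radial_sum A ((*\<^sub>R) \<alpha> ` cball 0 1)} \<noteq> {}"
    using mem_radial_sum_ball[of "norm x + 1" x A] norm_ge_zero[of x]
    by (auto intro!: exI[of _ "norm x + 1"] simp: add_nonneg_pos)
qed auto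

lemma radial_infdist_le_norm: "radial_infdist x A \<le> norm x"
proof (rule field_le_epsilon)
  fix e :: real assume "e > 0"
  then have "0 < norm x + e" using norm_ge_zero[of x] by linarith
  with \<open>e > 0\<close> show "radial_infdist x A \<le> norm x + e"
    unfolding radial_infdist_def
    by (intro cInf_lower mem_radial_sum_ball CollectI conjI bdd_belowI[of _ 0]) auto
qed

lemma bdd_above_radial_AW:
  "bdd_above ((\<lambda>x. \<bar>radial_infdist x A - radial_infdist x B\<bar>) ` {x. norm x \<le> real j})"
proof (rule bdd_aboveI2[where M = "real j"])
  fix x :: 'a assume "x \<in> {x. norm x \<le> real j}"
  then show "\<bar>radial_infdist x A - radial_infdist x B\<bar> \<le> real j"
    using radial_infdist_nonneg[of x A] radial_infdist_nonneg[of x B]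
      radial_infdist_le_norm[of x A] radial_infdist_le_norm[of x B] by auto
qed

lemma bdd_above_AW:
  "bdd_above ((\<lambda>x::'a::euclidean_space. \<bar>infdist x A - infdist x B\<bar>) ` {x. norm x < real j})"
proof (rule bdd_aboveI2[where M = "real j + infdist 0 A + infdist 0 B"])
  fix x :: 'a assume "x \<in> {x. norm x < real j}"
  then show "\<bar>infdist x A - infdist x B\<bar> \<le> real j + infdist 0 A + infdist 0 B"
    using infdist_triangle[of x A 0] infdist_triangle[of x B 0]
      infdist_nonneg[of x A] infdist_nonneg[of x B] infdist_nonneg[of 0 A] infdist_nonneg[of 0 B]
    by (auto simp: dist_norm)
qed

end

theory Submission
  imports Defs
begin

text \<open>The ordinary distance to a star body is at most the radial one, and both vanish on the body.
  A nearest point \<open>a\<close> of a closed star body \<open>A1\<close> to \<open>x\<close> satisfies \<open>\<parallel>a\<parallel> \<le> \<parallel>x\<parallel>\<close>,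
  since it is also nearest among the points \<open>t a\<close> with \<open>0 \<le> t \<le> 1\<close>. Hence
  \<open>d(x,A2) - d(x,A1) \<le> d(a,A2) \<le> d_r(a,A2) - d_r(a,A1)\<close> with \<open>\<parallel>a\<parallel> \<le> \<parallel>x\<parallel>\<close>, so already the
  inner suprema are comparable for every \<open>j\<close>.\<close>

text \<open>Limits how far a radial sum with the ball can extend a set along one ray.\<close>

lemma radial_fun_ball_le:
  assumes "norm \<theta> = 1" "0 < \<alpha>"
  shows "radial_fun ((*\<^sub>R) \<alpha> ` cball (0::'a::euclidean_space) 1) \<theta> \<le> ennreal \<alpha>"
  unfolding radial_fun_def
proof (rule SUP_least, clarsimp)
  fix l and y :: 'a
  assume "0 \<le> l" "norm y \<le> 1" and eq: "l *\<^sub>R \<theta> = \<alpha> *\<^sub>R y"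
  have "l = \<alpha> * norm y"
    using arg_cong[OF eq, of norm] \<open>0 \<le> l\<close> assms by simp
  also have "\<dots> \<le> \<alpha>"
    using \<open>norm y \<le> 1\<close> assms by (simp add: mult_left_le)
  finally show "ennreal l \<le> ennreal \<alpha>"
    by (rule ennreal_leI)
qed

text \<open>Moving \<open>x\<close> by \<alpha> towards the origin along its own ray lands in
  \<open>A\<close>, unless the origin, a point of \<open>A\<close>, is already within \<alpha> of
  \<open>x\<close>.\<close>

lemma infdist_le_radial_sum_ball:
  fixes A :: "'a::euclidean_space set"
  assumes A: "star_body A" and "0 < \<alpha>"
    and x: "x \<in> radial_sum A ((*\<^sub>R) \<alpha> ` cball 0 1)"
  shows "infdist x A \<le> \<alpha>"
proof (cases "norm x \<le> \<alpha>")
  case True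
  have "0 \<in> A"
    using A star_set_zero by (auto simp: star_body_def)
  then show ?thesis
    using infdist_le[of 0 A x] True by simp
next
  case False
  let ?\<theta> = "sgn x"
  have "x \<noteq> 0" and \<theta>: "norm ?\<theta> = 1"
    using False \<open>0 < \<alpha>\<close> by (auto simp: norm_sgn)
  then have x_eq: "norm x *\<^sub>R ?\<theta> = x"
    by (simp add: sgn_div_norm)
  have "ennreal (norm x - \<alpha>) + ennreal \<alpha> = ennreal (norm x)"
    using False \<open>0 < \<alpha>\<close> by (simp flip: ennreal_plus)
  also have "\<dots> \<le> radial_fun (radial_sum A ((*\<^sub>R) \<alpha> ` cball 0 1)) ?\<theta>"
    using star_body_mem_iff[OF star_body_radial_sum \<theta> norm_ge_zero[of x]] x x_eq by metis
  also have "\<dots> \<le> radial_fun A ?\<theta> + ennreal \<alpha>"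
    using radial_fun_ball_le[OF \<theta> \<open>0 < \<alpha>\<close>] \<theta> by (simp add: radial_fun_radial_sum add_left_mono)
  \<comment> \<open>\<alpha> is finite as an extended real, so it cancels even if the radial
    function is infinite.\<close>
  finally have "ennreal (norm x - \<alpha>) \<le> radial_fun A ?\<theta>"
    by (simp add: ennreal_add_left_cancel_le add.commute)
  then have "(norm x - \<alpha>) *\<^sub>R ?\<theta> \<in> A"
    using star_body_mem_iff[OF A \<theta>] False by simp
  moreover have "x - (norm x - \<alpha>) *\<^sub>R ?\<theta> = \<alpha> *\<^sub>R ?\<theta>"
    using x_eq by (simp add: scaleR_diff_left)
  then have "dist x ((norm x - \<alpha>) *\<^sub>R ?\<theta>) = \<alpha>"
    using \<theta> \<open>0 < \<alpha>\<close> by (simp add: dist_norm)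
  ultimately show ?thesis
    using infdist_le by metis
qed

lemma infdist_le_radial_infdist:
  assumes "star_body A"
  shows "infdist x A \<le> radial_infdist x A"
  unfolding radial_infdist_def
proof (rule cInf_greatest)
  \<comment> \<open>An admissible radius: the ball alone reaches \<open>x\<close>, and adding 1
    keeps the radius positive when \<open>x\<close> is the origin.\<close>
  have "0 < norm x + 1"
    using norm_ge_zero[of x] by linarith
  then show "{\<alpha>. \<alpha> > 0 \<and> x \<in> radial_sum A ((*\<^sub>R) \<alpha> ` cball 0 1)} \<noteq> {}"
    using mem_radial_sum_ball[of "norm x + 1" x A] by fastforce
qed (use infdist_le_radial_sum_ball[OF assms] in auto)

lemma subset_radial_sum:
  fixes A B :: "'a::euclidean_space set"
  assumes "star_body A"
  shows "A \<subseteq> radial_sum A B"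
proof
  fix x assume "x \<in> A"
  show "x \<in> radial_sum A B"
  proof (cases "x = 0")
    case True
    then show ?thesis
      using star_body_radial_sum star_set_zero unfolding star_body_def by blast
  next
    case False
    then have \<theta>: "norm (sgn x) = 1" and x_eq: "norm x *\<^sub>R sgn x = x"
      by (simp_all add: norm_sgn sgn_div_norm)
    have "ennreal (norm x) \<le> radial_fun A (sgn x)"
      using star_body_mem_iff[OF assms \<theta> norm_ge_zero[of x]] x_eq \<open>x \<in> A\<close> by simp
    then have "ennreal (norm x) \<le> radial_fun (radial_sum A B) (sgn x)"
      using \<theta> by (simp add: radial_fun_radial_sum add_increasing2)
    then show ?thesis
      using star_body_mem_iff[OF star_body_radial_sum \<theta> norm_ge_zero[of x]] x_eq by metis
  qed
qed

text \<open>\<open>A\<close> lies in its radial sum with any ball, so arbitrarily small radii are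
  admissible in the infimum.\<close>

lemma radial_infdist_zero:
  assumes "star_body A" "x \<in> A"
  shows "radial_infdist x A = 0"
proof (rule antisym)
  show "radial_infdist x A \<le> 0"
  proof (rule field_le_epsilon)
    fix e :: real assume "e > 0"
    then show "radial_infdist x A \<le> 0 + e"
      unfolding radial_infdist_def using subset_radial_sum[OF assms(1)] assms(2)
      by (intro cInf_lower bdd_belowI[of _ 0]) auto
  qed
qed (rule radial_infdist_nonneg)

text \<open>If \<open>a\<close> were longer than \<open>x\<close>, shrinking it to the length of
  \<open>x\<close> would bring it strictly closer to \<open>x\<close>.\<close>

lemma star_set_nearest_norm_le:
  fixes A :: "'a::euclidean_space set"
  assumes A: "star_set A" "a \<in> A" and near: "\<And>y. y \<in> A \<Longrightarrow> dist x a \<le> dist x y"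
  shows "norm a \<le> norm x"
proof (rule ccontr)
  assume less: "\<not> norm a \<le> norm x"
  define t where "t = norm x / norm a"
  have "norm a > 0"
    using less norm_ge_zero[of x] by linarith
  then have t: "0 \<le> t" "t < 1" and ta: "t * norm a = norm x"
    using less by (auto simp: t_def)
  have "t *\<^sub>R a \<in> A"
    using A t by (auto simp: star_set_def)
  then have "(dist x a)\<^sup>2 \<le> (dist x (t *\<^sub>R a))\<^sup>2"
    using near by (simp add: power_mono)
  then have "(norm a)\<^sup>2 - (t * norm a)\<^sup>2 \<le> 2 * (1 - t) * (x \<bullet> a)"
    unfolding dist_norm power_mult_distrib power2_norm_eq_inner
    by (simp add: inner_diff inner_commute algebra_simps power2_eq_square)
  also have "\<dots> \<le> 2 * (1 - t) * (norm x * norm a)"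
    using t norm_cauchy_schwarz by (intro mult_left_mono) auto
  \<comment> \<open>With \<open>norm x\<close> written as \<open>t * norm a\<close>, the
    coefficients combine to (1 - t^2) - 2 t (1 - t) = (1 - t)^2.\<close>
  finally have "(1 - t) * (1 - t) * (norm a)\<^sup>2 \<le> 0"
    unfolding ta[symmetric] by (simp add: algebra_simps power2_eq_square)
  then show False
    using t \<open>norm a > 0\<close> by (simp add: mult_le_0_iff)
qed

text \<open>One-sided; the right-hand side is symmetric in \<open>A\<close> and \<open>B\<close>, so
  exchanging them yields the absolute value.\<close>

lemma infdist_diff_le_SUP_radial_infdist:
  fixes A B :: "'a::euclidean_space set"
  assumes A: "star_body A" "closed A" and B: "star_body B" and x: "norm x < real j"
  shows "infdist x B - infdist x A
    \<le> (SUP x\<in>{x. norm x \<le> real j}. \<bar>radial_infdist x A - radial_infdist x B\<bar>)"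
proof -
  have S: "star_set A"
    using A by (simp add: star_body_def)
  then have "A \<noteq> {}"
    by (simp add: star_set_def)
  then obtain a where a: "a \<in> A" "infdist x A = dist x a"
    using infdist_attains_inf[OF A(2)] by metis
  then have "norm a \<le> norm x"
    by (intro star_set_nearest_norm_le[OF S]) (simp_all add: infdist_le flip: a(2))
  \<comment> \<open>Since \<open>a\<close> lies in \<open>A\<close>, the left-hand side is just
    \<open>radial_infdist a B\<close>.\<close>
  then have "\<bar>radial_infdist a A - radial_infdist a B\<bar>
      \<le> (SUP x\<in>{x. norm x \<le> real j}. \<bar>radial_infdist x A - radial_infdist x B\<bar>)"
    using x by (intro cSUP_upper bdd_above_radial_AW) auto
  moreover have "infdist x B \<le> infdist a B + dist x a"
    by (rule infdist_triangle)
  moreover have "infdist a B \<le> radial_infdist a B"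
    by (rule infdist_le_radial_infdist[OF B])
  ultimately show ?thesis
    using radial_infdist_zero[OF A(1) a(1)] a(2) by linarith
qed

lemma AW_dist_le_radial_AW_dist:
  fixes A B :: "'a::euclidean_space set"
  assumes A: "star_body A" "closed A" and B: "star_body B" "closed B"
  shows "AW_dist A B \<le> radial_AW_dist A B"
  unfolding AW_dist_def radial_AW_dist_def
proof (rule cSUP_mono)
  let ?R = "\<lambda>j. SUP x\<in>{x. norm x \<le> real j}. \<bar>radial_infdist x A - radial_infdist x B\<bar>"
  show "bdd_above ((\<lambda>j. min (1 / real j) (?R j)) ` {1..})"
    by (rule bdd_aboveI2[where M = 1]) (simp add: min.coboundedI1)
  fix j :: nat assume j: "j \<in> {1..}"
  have "(SUP x\<in>{x. norm x < real j}. \<bar>infdist x A - infdist x B\<bar>) \<le> ?R j"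
  proof (rule cSUP_least)
    \<comment> \<open>The open ball contains the origin because \<open>j\<close> is at least 1; for
      index 0 it would be empty.\<close>
    show "{x::'a. norm x < real j} \<noteq> {}"
      using j by (auto intro!: exI[of _ 0])
    fix x :: 'a assume "x \<in> {x. norm x < real j}"
    then show "\<bar>infdist x A - infdist x B\<bar> \<le> ?R j"
      using infdist_diff_le_SUP_radial_infdist[OF A B(1), of x j]
        infdist_diff_le_SUP_radial_infdist[OF B A(1), of x j]
      by (simp add: abs_le_iff abs_minus_commute)
  qed
  \<comment> \<open>The two families compare index by index, so \<open>m\<close> is \<open>j\<close>
    itself.\<close>
  with j show "\<exists>m\<in>{1..}. min (1 / real j)
      (SUP x\<in>{x. norm x < real j}. \<bar>infdist x A - infdist x B\<bar>) \<le> min (1 / real m) (?R m)"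
    by (intro bexI[of _ j] min.mono) auto
qed simp

theorem proposition4p7:
  fixes A1 A2 :: "(real ^ 'n) set"
  assumes "CARD('n) \<ge> 2"
    and "star_body A1" and "closed A1"
    and "star_body A2" and "closed A2"
  shows "AW_dist A1 A2 \<le> radial_AW_dist A1 A2"
  using assms by (intro AW_dist_le_radial_AW_dist)

end
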